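(* Let $\tau>0$. For $u\in L^2(\Omega)$, denote by $G_\tau u$ the solution $w$ of the PDE $(1-\tau\Delta)w=u$. Define \[ F_\tau(u)=\begin{cases}\dfrac{1}{2\tau}\displaystyle\int_\Omega(1-u)\,G_\tau(1+u)\,dx&\text{if }|u|\leq 1\text{ a.e.}\\[2mm]+\infty&\text{else}\end{cases},\qquad d_\tau(u,v)=\sqrt{\int_\Omega(u-v)\,G_\tau(u-v)\,dx}. \] Let $\varepsilon>0$ and let the sequences $(u_n)$, $(\tilde u_n)$ be generated by the iteration \[ \tilde u_n=\operatorname{sign}(u_n),\qquad\left(1-\frac{\varepsilon^2}{2}\Delta\right)u_{n+1}=\tilde u_n . \] Then $\tilde u_{n+1}$ is the solution of the minimizing movements scheme \[ u\in\operatorname*{argmin}\; F_\tau(u)+\frac{1}{2\tau}\,d_\tau^2(u,\tilde u_n) \] for $\tau=\frac{\varepsilon^2}{2}$. In particular, $F_{\varepsilon^2/2}(\tilde u_{n+1})\leq F_{\varepsilon^2/2}(\tilde u_n)$.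
   Context: $\Omega$ is the spatial domain. The equation $(1-\tau\Delta)w=u$ is solved with a fixed boundary condition, and the solution operator $G_\tau=(1-\tau\Delta)^{-1}:L^2(\Omega)\to L^2(\Omega)$ is assumed to be well-defined, positive semi-definite and self-adjoint. The boundary conditions of interest are: constant Dirichlet conditions $\equiv 1$ on a relatively closed and open subset $\Gamma\subseteq\partial\Omega$ and $\equiv -1$ on $\partial\Omega\setminus\Gamma$ (in which case the solution operator is not linear but affine-linear); homogeneous Neumann conditions; and periodic conditions. It is convenient to assume that $\{u_n=0\}$ is a null set, but the tie may also be broken arbitrarily by assigning $\operatorname{sign}(0)$ as either $-1$ or $1$. The iteration is the convex-concave splitting scheme, with formally infinite step size, for the Allen-Cahn equation $\partial_t u=\Delta u-\overline W'(u)/\varepsilon^2$ with potential $\overline W(u)=(|u|-1)^2=u^2+(1-2|u|)$, where $u^2$ is the convex part and $1-2|u|$ the concave part.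
   Formalization: Self-adjointness is required of the whole solution operator, not just its linear part; this excludes the affine-linear Dirichlet ±1 case, where the claim as printed fails. Ω has finite measure, and uniqueness of the minimizer is stated when {u_{n+1}=0} is a null set. *)

theory Defs
  imports "HOL-Analysis.Analysis"
begin

section \<open>Square-integrable functions\<close>

text \<open>Elements of \<open>L\<^sup>2(\<Omega>)\<close> are represented by functions; equality in \<open>L\<^sup>2(\<Omega>)\<close> is equality almost
  everywhere on \<open>\<Omega>\<close>. Values outside \<open>\<Omega>\<close> are irrelevant.\<close>

definition L2 :: "'a::euclidean_space set \<Rightarrow> ('a \<Rightarrow> 'b::euclidean_space) set" where
  "L2 \<Omega> = {f \<in> borel_measurable (lebesgue_on \<Omega>). integrable (lebesgue_on \<Omega>) (\<lambda>x. (norm (f x))\<^sup>2)}"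

definition L2_inner :: "'a::euclidean_space set \<Rightarrow> ('a \<Rightarrow> 'b::euclidean_space) \<Rightarrow> ('a \<Rightarrow> 'b) \<Rightarrow> real" where
  "L2_inner \<Omega> f g = (LINT x|lebesgue_on \<Omega>. f x \<bullet> g x)"

section \<open>Smooth functions and weak gradients\<close>

primrec C_k :: "nat \<Rightarrow> ('a::euclidean_space \<Rightarrow> real) \<Rightarrow> bool" where
  "C_k 0 f \<longleftrightarrow> continuous_on UNIV f"
| "C_k (Suc k) f \<longleftrightarrow> f differentiable_on UNIV \<and>
     (\<forall>i\<in>Basis. C_k k (\<lambda>x. frechet_derivative f (at x) i))"

definition smooth :: "('a::euclidean_space \<Rightarrow> real) \<Rightarrow> bool" where
  "smooth f \<longleftrightarrow> (\<forall>k. C_k k f)"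

definition grad :: "('a::euclidean_space \<Rightarrow> real) \<Rightarrow> 'a \<Rightarrow> 'a" where
  "grad f x = (\<Sum>i\<in>Basis. frechet_derivative f (at x) i *\<^sub>R i)"

definition Cc_smooth :: "'a::euclidean_space set \<Rightarrow> ('a \<Rightarrow> real) set" where
  "Cc_smooth \<Omega> = {\<phi>. smooth \<phi> \<and> compact (closure {x. \<phi> x \<noteq> 0}) \<and> closure {x. \<phi> x \<noteq> 0} \<subseteq> \<Omega>}"

definition periodic_smooth :: "'a::euclidean_space \<Rightarrow> 'a \<Rightarrow> ('a \<Rightarrow> real) set" where
  "periodic_smooth a b = {\<phi>. smooth \<phi> \<and> (\<forall>i\<in>Basis. \<forall>x. \<phi> (x + ((b - a) \<bullet> i) *\<^sub>R i) = \<phi> x)}"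

text \<open>\<open>H1 T \<Omega> w p\<close>: \<open>w\<close> and \<open>p\<close> are square-integrable and \<open>p\<close> is the weak gradient of \<open>w\<close> with
  respect to the test functions \<open>T\<close>. For \<open>T = Cc_smooth \<Omega>\<close> this is the Sobolev space \<open>H\<^sup>1(\<Omega>)\<close>; for
  \<open>T = periodic_smooth a b\<close> and \<open>\<Omega> = box a b\<close> it is \<open>H\<^sup>1\<close> of the flat torus, because testing with
  periodic functions excludes jumps across opposite faces.\<close>

definition H1 :: "('a::euclidean_space \<Rightarrow> real) set \<Rightarrow> 'a set \<Rightarrow> ('a \<Rightarrow> real) \<Rightarrow> ('a \<Rightarrow> 'a) \<Rightarrow> bool" where
  "H1 T \<Omega> w p \<longleftrightarrow> w \<in> L2 \<Omega> \<and> p \<in> L2 \<Omega> \<and>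
     (\<forall>\<phi>\<in>T. \<forall>i\<in>Basis. (LINT x|lebesgue_on \<Omega>. w x * (grad \<phi> x \<bullet> i))
                     = - (LINT x|lebesgue_on \<Omega>. (p x \<bullet> i) * \<phi> x))"

section \<open>Boundary conditions and weak solutions\<close>

text \<open>\<open>Dirichlet \<Gamma>\<close>: boundary values \<open>1\<close> on \<open>\<Gamma>\<close> and \<open>-1\<close> on the rest of the boundary; \<open>Neumann\<close>:
  homogeneous Neumann; \<open>Periodic a b\<close>: periodic on the box with corners \<open>a\<close> and \<open>b\<close>.\<close>

datatype 'a bc = Dirichlet "'a set" | Neumann | Periodic 'a 'a

fun bc_for :: "'a::euclidean_space bc \<Rightarrow> 'a set \<Rightarrow> bool" where
  "bc_for (Dirichlet \<Gamma>) \<Omega> \<longleftrightarrow>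
     openin (top_of_set (frontier \<Omega>)) \<Gamma> \<and> closedin (top_of_set (frontier \<Omega>)) \<Gamma>"
| "bc_for Neumann \<Omega> \<longleftrightarrow> True"
| "bc_for (Periodic a b) \<Omega> \<longleftrightarrow> \<Omega> = box a b \<and> (\<forall>i\<in>Basis. a \<bullet> i < b \<bullet> i)"

text \<open>The Dirichlet values are imposed without assuming any regularity of the boundary: the admissible
  functions are the \<open>H\<^sup>1\<close>-closure of the smooth functions equal to \<open>1\<close> near \<open>\<Gamma>\<close> and to \<open>-1\<close> near the
  rest of the boundary. This is an affine space over \<open>H\<^sup>1\<^sub>0(\<Omega>)\<close>. The argument \<open>p\<close> is the weak gradient.\<close>

fun trial :: "'a::euclidean_space bc \<Rightarrow> 'a set \<Rightarrow> ('a \<Rightarrow> real) \<Rightarrow> ('a \<Rightarrow> 'a) \<Rightarrow> bool" where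
  "trial (Dirichlet \<Gamma>) \<Omega> w p \<longleftrightarrow> H1 (Cc_smooth \<Omega>) \<Omega> w p \<and>
     (\<forall>e>0. \<exists>v. smooth v \<and> v \<in> L2 \<Omega> \<and> grad v \<in> L2 \<Omega> \<and>
        (\<exists>U. open U \<and> \<Gamma> \<subseteq> U \<and> (\<forall>x\<in>U. v x = 1)) \<and>
        (\<exists>U. open U \<and> frontier \<Omega> - \<Gamma> \<subseteq> U \<and> (\<forall>x\<in>U. v x = - 1)) \<and>
        (LINT x|lebesgue_on \<Omega>. (w x - v x)\<^sup>2) + (LINT x|lebesgue_on \<Omega>. (norm (p x - grad v x))\<^sup>2) < e)"
| "trial Neumann \<Omega> w p \<longleftrightarrow> H1 (Cc_smooth \<Omega>) \<Omega> w p"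
| "trial (Periodic a b) \<Omega> w p \<longleftrightarrow> H1 (periodic_smooth a b) \<Omega> w p"

fun test :: "'a::euclidean_space bc \<Rightarrow> 'a set \<Rightarrow> ('a \<Rightarrow> real) \<Rightarrow> ('a \<Rightarrow> 'a) \<Rightarrow> bool" where
  "test (Dirichlet \<Gamma>) \<Omega> \<phi> q \<longleftrightarrow> \<phi> \<in> Cc_smooth \<Omega> \<and> q = grad \<phi>"
| "test Neumann \<Omega> \<phi> q \<longleftrightarrow> H1 (Cc_smooth \<Omega>) \<Omega> \<phi> q"
| "test (Periodic a b) \<Omega> \<phi> q \<longleftrightarrow> H1 (periodic_smooth a b) \<Omega> \<phi> q"

text \<open>\<open>w\<close> is a weak solution of \<open>(1 - \<tau>\<Delta>)w = f\<close> in \<open>\<Omega>\<close> with the boundary condition \<open>B\<close>.\<close>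

definition weak_solution ::
  "'a::euclidean_space bc \<Rightarrow> 'a set \<Rightarrow> real \<Rightarrow> ('a \<Rightarrow> real) \<Rightarrow> ('a \<Rightarrow> real) \<Rightarrow> bool" where
  "weak_solution B \<Omega> \<tau> f w \<longleftrightarrow> (\<exists>p. trial B \<Omega> w p \<and>
     (\<forall>\<phi> q. test B \<Omega> \<phi> q \<longrightarrow> L2_inner \<Omega> w \<phi> + \<tau> * L2_inner \<Omega> p q = L2_inner \<Omega> f \<phi>))"

section \<open>The solution operator\<close>

definition well_posed :: "'a::euclidean_space bc \<Rightarrow> 'a set \<Rightarrow> real \<Rightarrow> bool" where
  "well_posed B \<Omega> \<tau> \<longleftrightarrow> (\<forall>f\<in>L2 \<Omega>. \<exists>w. weak_solution B \<Omega> \<tau> f w \<and>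
     (\<forall>w'. weak_solution B \<Omega> \<tau> f w' \<longrightarrow> (AE x in lebesgue_on \<Omega>. w' x = w x)))"

definition G :: "'a::euclidean_space bc \<Rightarrow> 'a set \<Rightarrow> real \<Rightarrow> ('a \<Rightarrow> real) \<Rightarrow> 'a \<Rightarrow> real" where
  "G B \<Omega> \<tau> f = (SOME w. weak_solution B \<Omega> \<tau> f w)"

text \<open>An everywhere defined self-adjoint operator is automatically linear, so no separate linearity is
  required; the affine-linear operators of inhomogeneous Dirichlet problems are not self-adjoint.\<close>

definition self_adjoint_L2 :: "'a::euclidean_space set \<Rightarrow> (('a \<Rightarrow> real) \<Rightarrow> 'a \<Rightarrow> real) \<Rightarrow> bool" where
  "self_adjoint_L2 \<Omega> A \<longleftrightarrow> (\<forall>f\<in>L2 \<Omega>. \<forall>g\<in>L2 \<Omega>. L2_inner \<Omega> (A f) g = L2_inner \<Omega> f (A g))"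

definition pos_semidef_L2 :: "'a::euclidean_space set \<Rightarrow> (('a \<Rightarrow> real) \<Rightarrow> 'a \<Rightarrow> real) \<Rightarrow> bool" where
  "pos_semidef_L2 \<Omega> A \<longleftrightarrow> (\<forall>f\<in>L2 \<Omega>. 0 \<le> L2_inner \<Omega> f (A f))"

section \<open>Energy, distance and the sign step\<close>

definition F :: "'a::euclidean_space bc \<Rightarrow> 'a set \<Rightarrow> real \<Rightarrow> ('a \<Rightarrow> real) \<Rightarrow> ereal" where
  "F B \<Omega> \<tau> u =
     (if AE x in lebesgue_on \<Omega>. \<bar>u x\<bar> \<le> 1
      then ereal (1 / (2 * \<tau>) * (LINT x|lebesgue_on \<Omega>. (1 - u x) * G B \<Omega> \<tau> (\<lambda>y. 1 + u y) x))
      else \<infinity>)"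

definition d :: "'a::euclidean_space bc \<Rightarrow> 'a set \<Rightarrow> real \<Rightarrow> ('a \<Rightarrow> real) \<Rightarrow> ('a \<Rightarrow> real) \<Rightarrow> real" where
  "d B \<Omega> \<tau> u v =
     sqrt (LINT x|lebesgue_on \<Omega>. (u x - v x) * G B \<Omega> \<tau> (\<lambda>y. u y - v y) x)"

text \<open>\<open>v = sign(u)\<close> a.e., where on \<open>{u = 0}\<close> the value of \<open>v\<close> may be either of \<open>-1\<close> and \<open>1\<close>, chosen
  pointwise; measurability restricts only this choice.\<close>

definition is_sign :: "'a::euclidean_space set \<Rightarrow> ('a \<Rightarrow> real) \<Rightarrow> ('a \<Rightarrow> real) \<Rightarrow> bool" where
  "is_sign \<Omega> u v \<longleftrightarrow> v \<in> borel_measurable (lebesgue_on \<Omega>) \<and>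
     (AE x in lebesgue_on \<Omega>. if u x = 0 then v x \<in> {-1, 1} else v x = sgn (u x))"

text \<open>The minimizing movements functional \<open>v \<mapsto> F\<^sub>\<tau>(v) + d\<^sub>\<tau>\<^sup>2(v, z) / (2\<tau>)\<close>.\<close>

definition mm_functional ::
  "'a::euclidean_space bc \<Rightarrow> 'a set \<Rightarrow> real \<Rightarrow> ('a \<Rightarrow> real) \<Rightarrow> ('a \<Rightarrow> real) \<Rightarrow> ereal" where
  "mm_functional B \<Omega> \<tau> z v = F B \<Omega> \<tau> v + ereal (1 / (2 * \<tau>) * (d B \<Omega> \<tau> v z)\<^sup>2)"

end

theory Submission
  imports Defs
begin

text \<open>For \<open>\<bar>v\<bar> \<le> 1\<close> the quadratic terms \<open>\<langle>v, Gv\<rangle>\<close> of \<open>F\<close> and of the squared distance cancel, so that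
  the functional of the scheme is affine in \<open>v\<close>: up to a constant it is \<open>- \<langle>v, Gz\<rangle> / \<tau>\<close>. On the
  functions with values in \<open>[-1, 1]\<close> this is minimal exactly at the signs of \<open>Gz\<close>.\<close>

lemma L2_measurable: "f \<in> L2 \<Omega> \<Longrightarrow> f \<in> borel_measurable (lebesgue_on \<Omega>)"
  by (simp add: L2_def)

lemma integrable_L2_inner:
  assumes "f \<in> L2 \<Omega>" and "g \<in> L2 \<Omega>"
  shows "integrable (lebesgue_on \<Omega>) (\<lambda>x. f x \<bullet> g x)"
proof (rule Bochner_Integration.integrable_bound)
  show "integrable (lebesgue_on \<Omega>) (\<lambda>x. (norm (f x))\<^sup>2 + (norm (g x))\<^sup>2)"
    using assms by (simp add: L2_def)
  show "(\<lambda>x. f x \<bullet> g x) \<in> borel_measurable (lebesgue_on \<Omega>)"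
    using assms by (intro borel_measurable_inner L2_measurable)
  have "\<bar>f x \<bullet> g x\<bar> \<le> (norm (f x))\<^sup>2 + (norm (g x))\<^sup>2" for x
  proof -
    have "2 * (norm (f x) * norm (g x)) \<le> (norm (f x))\<^sup>2 + (norm (g x))\<^sup>2"
      using sum_squares_bound[of "norm (f x)" "norm (g x)"] by simp
    moreover have "0 \<le> norm (f x) * norm (g x)" by simp
    ultimately show ?thesis
      using Cauchy_Schwarz_ineq2[of "f x" "g x"] by linarith
  qed
  then show "AE x in lebesgue_on \<Omega>. norm (f x \<bullet> g x) \<le> norm ((norm (f x))\<^sup>2 + (norm (g x))\<^sup>2)"
    by simp
qed

lemma L2_add:
  assumes "f \<in> L2 \<Omega>" and "g \<in> L2 \<Omega>"
  shows "(\<lambda>x. f x + g x) \<in> L2 \<Omega>"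
proof -
  have "(norm (f x + g x))\<^sup>2 = f x \<bullet> f x + 2 * (f x \<bullet> g x) + g x \<bullet> g x" for x
    by (simp add: power2_norm_eq_inner inner_add_left inner_add_right inner_commute)
  moreover have "(\<lambda>x. f x + g x) \<in> borel_measurable (lebesgue_on \<Omega>)"
    using assms by (intro borel_measurable_add L2_measurable)
  ultimately show ?thesis
    using assms by (simp add: L2_def[of \<Omega>] integrable_L2_inner)
qed

lemma L2_uminus: "f \<in> L2 \<Omega> \<Longrightarrow> (\<lambda>x. - f x) \<in> L2 \<Omega>"
  by (simp add: L2_def)

lemma L2_diff: "f \<in> L2 \<Omega> \<Longrightarrow> g \<in> L2 \<Omega> \<Longrightarrow> (\<lambda>x. f x - g x) \<in> L2 \<Omega>"
  using L2_add[OF _ L2_uminus, of f \<Omega> g] by simp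

text \<open>Constants are integrable on a set of finite measure. This puts the constant 1 in
  \<open>F\<close> and all sign functions of the scheme into the domain of the solution
  operator.\<close>

lemma L2_bounded:
  assumes "open \<Omega>" and "emeasure lebesgue \<Omega> < \<infinity>"
    and "f \<in> borel_measurable (lebesgue_on \<Omega>)"
    and "AE x in lebesgue_on \<Omega>. norm (f x) \<le> c"
  shows "f \<in> L2 \<Omega>"
proof -
  have "finite_measure (lebesgue_on \<Omega>)"
    using assms(1,2)
    by (intro finite_measureI) (simp add: emeasure_restrict_space borel_open space_restrict_space)
  moreover have "AE x in lebesgue_on \<Omega>. norm ((norm (f x))\<^sup>2) \<le> c\<^sup>2"
    using assms(4) by (auto elim!: eventually_mono intro: power_mono)
  ultimately show ?thesis
    using assms(3) by (auto simp: L2_def intro!: finite_measure.integrable_const_bound)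
qed

lemma L2_inner_commute: "L2_inner \<Omega> f g = L2_inner \<Omega> g f"
  by (simp add: L2_inner_def inner_commute)

lemma L2_inner_add_left:
  assumes "f \<in> L2 \<Omega>" and "g \<in> L2 \<Omega>" and "h \<in> L2 \<Omega>"
  shows "L2_inner \<Omega> (\<lambda>x. f x + g x) h = L2_inner \<Omega> f h + L2_inner \<Omega> g h"
  using assms by (simp add: L2_inner_def inner_add_left integrable_L2_inner)

lemma L2_inner_diff_left:
  assumes "f \<in> L2 \<Omega>" and "g \<in> L2 \<Omega>" and "h \<in> L2 \<Omega>"
  shows "L2_inner \<Omega> (\<lambda>x. f x - g x) h = L2_inner \<Omega> f h - L2_inner \<Omega> g h"
  using assms by (simp add: L2_inner_def inner_diff_left integrable_L2_inner)

text \<open>Linearity of \<open>A\<close> is not assumed: symmetry moves it to the other factor.\<close>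

lemma self_adjoint_L2_add:
  assumes "self_adjoint_L2 \<Omega> A" and "\<And>f. f \<in> L2 \<Omega> \<Longrightarrow> A f \<in> L2 \<Omega>"
    and "f \<in> L2 \<Omega>" and "g \<in> L2 \<Omega>" and "h \<in> L2 \<Omega>"
  shows "L2_inner \<Omega> h (A (\<lambda>x. f x + g x)) = L2_inner \<Omega> h (A f) + L2_inner \<Omega> h (A g)"
proof -
  have sym: "L2_inner \<Omega> h (A k) = L2_inner \<Omega> k (A h)" if "k \<in> L2 \<Omega>" for k
    using assms(1,5) that L2_inner_commute[of \<Omega> k] by (simp add: self_adjoint_L2_def)
  show ?thesis
    using assms by (simp add: sym L2_add L2_inner_add_left)
qed

lemma self_adjoint_L2_diff:
  assumes "self_adjoint_L2 \<Omega> A" and "\<And>f. f \<in> L2 \<Omega> \<Longrightarrow> A f \<in> L2 \<Omega>"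
    and "f \<in> L2 \<Omega>" and "g \<in> L2 \<Omega>" and "h \<in> L2 \<Omega>"
  shows "L2_inner \<Omega> h (A (\<lambda>x. f x - g x)) = L2_inner \<Omega> h (A f) - L2_inner \<Omega> h (A g)"
  \<comment> \<open>Additivity for the splitting \<open>f = (f - g) + g\<close>; no homogeneity of
    \<open>A\<close> enters.\<close>
  using self_adjoint_L2_add[OF assms(1,2) L2_diff[OF assms(3,4)] assms(4,5)] by simp

text \<open>With \<open>e\<close> the constant 1, the left side is 2\<tau> times the functional of
  the scheme. On expansion, \<open>v\<close> paired with \<open>A v\<close> occurs once with each
  sign, symmetry cancels the mixed terms of \<open>e\<close> and \<open>v\<close>, and it merges
  those of \<open>v\<close> and \<open>z\<close> into one term linear in \<open>v\<close>.\<close>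

lemma self_adjoint_L2_cancel:
  assumes "self_adjoint_L2 \<Omega> A" and "\<And>f. f \<in> L2 \<Omega> \<Longrightarrow> A f \<in> L2 \<Omega>"
    and "e \<in> L2 \<Omega>" and "v \<in> L2 \<Omega>" and "z \<in> L2 \<Omega>"
  shows "L2_inner \<Omega> (\<lambda>x. e x - v x) (A (\<lambda>x. e x + v x))
           + L2_inner \<Omega> (\<lambda>x. v x - z x) (A (\<lambda>x. v x - z x))
         = L2_inner \<Omega> e (A e) + L2_inner \<Omega> z (A z) - 2 * L2_inner \<Omega> v (A z)"
proof -
  have "L2_inner \<Omega> e (A v) = L2_inner \<Omega> v (A e)" "L2_inner \<Omega> z (A v) = L2_inner \<Omega> v (A z)"
    using assms L2_inner_commute[of \<Omega> v] by (simp_all add: self_adjoint_L2_def)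
  then show ?thesis
    using assms
    by (simp add: L2_inner_diff_left L2_add L2_diff self_adjoint_L2_add self_adjoint_L2_diff)
qed

lemma weak_solution_L2: "weak_solution B \<Omega> \<tau> f w \<Longrightarrow> w \<in> L2 \<Omega>"
  by (cases B) (auto simp: weak_solution_def H1_def)

lemma weak_solution_G:
  assumes "well_posed B \<Omega> \<tau>" and "f \<in> L2 \<Omega>"
  shows "weak_solution B \<Omega> \<tau> f (G B \<Omega> \<tau> f)"
  using assms unfolding G_def well_posed_def by (metis someI_ex)

text \<open>\<open>G\<close> is a choice among weak solutions, and the iterates of the scheme are
  weak solutions that need not be the chosen ones. This identifies the two almost everywhere, which
  integrals cannot distinguish.\<close>

lemma weak_solution_unique:
  assumes "well_posed B \<Omega> \<tau>" and "f \<in> L2 \<Omega>"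
    and "weak_solution B \<Omega> \<tau> f w" and "weak_solution B \<Omega> \<tau> f w'"
  shows "AE x in lebesgue_on \<Omega>. w x = w' x"
proof -
  obtain w0 where "\<And>w. weak_solution B \<Omega> \<tau> f w \<Longrightarrow> AE x in lebesgue_on \<Omega>. w x = w0 x"
    using assms(1,2) unfolding well_posed_def by blast
  from this[OF assms(3)] this[OF assms(4)] show ?thesis
    by eventually_elim simp
qed

lemma is_sign_AE_abs_le: "is_sign \<Omega> u v \<Longrightarrow> AE x in lebesgue_on \<Omega>. \<bar>v x\<bar> \<le> 1"
  unfolding is_sign_def by (elim conjE eventually_mono) (auto simp: sgn_if split: if_splits)

text \<open>Where \<open>u\<close> vanishes both sides are 0, so the way ties are broken never
  matters below.\<close>

lemma is_sign_AE_mult: "is_sign \<Omega> u v \<Longrightarrow> AE x in lebesgue_on \<Omega>. v x * u x = \<bar>u x\<bar>"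
  unfolding is_sign_def by (elim conjE eventually_mono) (auto simp: sgn_if split: if_splits)

text \<open>Pointwise, \<open>v x * u x\<close> is at most \<open>\<bar>u x\<bar>\<close>, which the
  sign attains. Equality of the integrals forces the nonnegative integrand
  \<open>(s x - v x) * u x\<close> to vanish almost everywhere; this determines \<open>v\<close>
  wherever \<open>u\<close> is nonzero.\<close>

lemma L2_inner_le_sign:
  assumes "is_sign \<Omega> u s" and "s \<in> L2 \<Omega>" and "v \<in> L2 \<Omega>" and "u \<in> L2 \<Omega>"
    and "AE x in lebesgue_on \<Omega>. \<bar>v x\<bar> \<le> 1"
  shows "L2_inner \<Omega> v u \<le> L2_inner \<Omega> s u"
    and "L2_inner \<Omega> v u = L2_inner \<Omega> s u \<Longrightarrow> AE x in lebesgue_on \<Omega>. v x * u x = s x * u x"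
proof -
  have nonneg: "AE x in lebesgue_on \<Omega>. 0 \<le> (s x - v x) * u x"
    using is_sign_AE_mult[OF assms(1)] assms(5)
  proof eventually_elim
    case (elim x)
    have "v x * u x \<le> \<bar>v x\<bar> * \<bar>u x\<bar>" by (metis abs_ge_self abs_mult)
    also have "\<dots> \<le> \<bar>u x\<bar>" using elim by (simp add: mult_left_le_one_le)
    finally show ?case using elim by (simp add: left_diff_distrib)
  qed
  have int: "integrable (lebesgue_on \<Omega>) (\<lambda>x. (s x - v x) * u x)"
    using integrable_L2_inner[OF L2_diff[OF assms(2,3)] assms(4)] by simp
  have eq: "(LINT x|lebesgue_on \<Omega>. (s x - v x) * u x) = L2_inner \<Omega> s u - L2_inner \<Omega> v u"
    using L2_inner_diff_left[OF assms(2,3,4)] by (simp add: L2_inner_def)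
  show "L2_inner \<Omega> v u \<le> L2_inner \<Omega> s u"
    using integral_nonneg_AE[OF nonneg] eq by simp
  assume "L2_inner \<Omega> v u = L2_inner \<Omega> s u"
  then have "AE x in lebesgue_on \<Omega>. (s x - v x) * u x = 0"
    using integral_nonneg_eq_0_iff_AE[OF int nonneg] eq by simp
  then show "AE x in lebesgue_on \<Omega>. v x * u x = s x * u x"
    by eventually_elim (auto simp: left_diff_distrib)
qed

text \<open>The real \<open>sqrt\<close> is odd, so for a negative argument squaring would return
  the absolute value; semi-definiteness excludes this.\<close>

lemma d_square:
  assumes "pos_semidef_L2 \<Omega> (G B \<Omega> \<tau>)" and "v \<in> L2 \<Omega>" and "z \<in> L2 \<Omega>"
  shows "(d B \<Omega> \<tau> v z)\<^sup>2 = L2_inner \<Omega> (\<lambda>x. v x - z x) (G B \<Omega> \<tau> (\<lambda>x. v x - z x))"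
  using assms L2_diff[OF assms(2,3)] by (simp add: d_def L2_inner_def pos_semidef_L2_def)

text \<open>Stated for an arbitrary weak solution \<open>w\<close> in place of
  \<open>G B \<Omega> \<tau> z\<close>, so that it applies directly to the next iterate.\<close>

lemma mm_functional_affine:
  assumes "open \<Omega>" and "emeasure lebesgue \<Omega> < \<infinity>"
    and "well_posed B \<Omega> \<tau>" and "self_adjoint_L2 \<Omega> (G B \<Omega> \<tau>)" and "pos_semidef_L2 \<Omega> (G B \<Omega> \<tau>)"
    and "v \<in> L2 \<Omega>" and "z \<in> L2 \<Omega>" and "AE x in lebesgue_on \<Omega>. \<bar>v x\<bar> \<le> 1"
    and "weak_solution B \<Omega> \<tau> z w"
  shows "mm_functional B \<Omega> \<tau> z v =
    ereal (1 / (2 * \<tau>) * (L2_inner \<Omega> (\<lambda>x. 1) (G B \<Omega> \<tau> (\<lambda>x. 1)) + L2_inner \<Omega> z (G B \<Omega> \<tau> z)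
      - 2 * L2_inner \<Omega> v w))"
proof -
  have G_L2: "G B \<Omega> \<tau> f \<in> L2 \<Omega>" if "f \<in> L2 \<Omega>" for f
    using weak_solution_L2[OF weak_solution_G[OF assms(3) that]] .
  have one: "(\<lambda>x. 1::real) \<in> L2 \<Omega>"
    using assms(1,2) by (intro L2_bounded[where c = 1]) auto
  have "AE x in lebesgue_on \<Omega>. G B \<Omega> \<tau> z x = w x"
    by (intro weak_solution_unique[OF assms(3,7)] weak_solution_G assms)
  then have "L2_inner \<Omega> v (G B \<Omega> \<tau> z) = L2_inner \<Omega> v w"
    unfolding L2_inner_def
    using L2_measurable[OF assms(6)] L2_measurable[OF G_L2[OF assms(7)]]
      L2_measurable[OF weak_solution_L2[OF assms(9)]]
    by (intro integral_cong_AE borel_measurable_inner) (auto elim: eventually_mono)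
  moreover have "F B \<Omega> \<tau> v
      = ereal (1 / (2 * \<tau>) * L2_inner \<Omega> (\<lambda>x. 1 - v x) (G B \<Omega> \<tau> (\<lambda>x. 1 + v x)))"
    using assms(8) by (simp add: F_def L2_inner_def)
  ultimately show ?thesis
    using self_adjoint_L2_cancel[OF assms(4) G_L2 one assms(6,7)]
    by (simp add: mm_functional_def d_square[OF assms(5,6,7)] flip: distrib_left add_divide_distrib)
qed

lemma mm_functional_infinite:
  "\<not> (AE x in lebesgue_on \<Omega>. \<bar>v x\<bar> \<le> 1) \<Longrightarrow> mm_functional B \<Omega> \<tau> z v = \<infinity>"
  by (simp add: mm_functional_def F_def)

theorem lemma4p3:
  fixes \<Omega> :: "'a::euclidean_space set" and B :: "'a bc" and \<epsilon> \<tau> :: real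
    and u ut :: "nat \<Rightarrow> 'a \<Rightarrow> real"
  assumes "open \<Omega>" and "emeasure lebesgue \<Omega> < \<infinity>"
    and "bc_for B \<Omega>"
    and "\<epsilon> > 0" and "\<tau> = \<epsilon>\<^sup>2 / 2"
    and "well_posed B \<Omega> \<tau>"
    and "self_adjoint_L2 \<Omega> (G B \<Omega> \<tau>)"
    and "pos_semidef_L2 \<Omega> (G B \<Omega> \<tau>)"
    and "\<And>n. is_sign \<Omega> (u n) (ut n)"
    and "\<And>n. weak_solution B \<Omega> (\<epsilon>\<^sup>2 / 2) (ut n) (u (Suc n))"
  shows "\<forall>n. is_arg_min (mm_functional B \<Omega> \<tau> (ut n)) (\<lambda>v. v \<in> L2 \<Omega>) (ut (Suc n))
           \<and> ((AE x in lebesgue_on \<Omega>. u (Suc n) x \<noteq> 0) \<longrightarrow>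
                (\<forall>v. is_arg_min (mm_functional B \<Omega> \<tau> (ut n)) (\<lambda>v. v \<in> L2 \<Omega>) v \<longrightarrow>
                   (AE x in lebesgue_on \<Omega>. v x = ut (Suc n) x)))
           \<and> F B \<Omega> \<tau> (ut (Suc n)) \<le> F B \<Omega> \<tau> (ut n)"
proof
  fix n
  let ?M = "mm_functional B \<Omega> \<tau> (ut n)" and ?s = "ut (Suc n)" and ?w = "u (Suc n)"
  have \<tau>: "\<tau> > 0"
    using assms(4,5) by (metis half_gt_zero zero_less_power)
  have bd: "AE x in lebesgue_on \<Omega>. \<bar>ut k x\<bar> \<le> 1" for k
    using assms(9) by (rule is_sign_AE_abs_le)
  have ut: "ut k \<in> L2 \<Omega>" for k
    using assms(1,2,9) bd[of k] by (intro L2_bounded[where c = 1]) (auto simp: is_sign_def)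
  have sol: "weak_solution B \<Omega> \<tau> (ut n) ?w"
    unfolding assms(5) by (rule assms(10))
  note w = weak_solution_L2[OF sol]
  \<comment> \<open>All terms free of \<open>v\<close> are collected in \<open>c\<close>, so
    minimizing \<open>?M\<close> over the functions bounded by 1 means maximizing the inner product
    with \<open>?w\<close>.\<close>
  obtain c where M: "\<And>v. v \<in> L2 \<Omega> \<Longrightarrow> AE x in lebesgue_on \<Omega>. \<bar>v x\<bar> \<le> 1 \<Longrightarrow>
      ?M v = ereal (1 / (2 * \<tau>) * (c - 2 * L2_inner \<Omega> v ?w))"
    using mm_functional_affine[OF assms(1,2,6,7,8) _ ut _ sol] by blast
  note sign = L2_inner_le_sign[OF assms(9) ut _ w]
  have min: "?M ?s \<le> ?M v" if "v \<in> L2 \<Omega>" for v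
  proof (cases "AE x in lebesgue_on \<Omega>. \<bar>v x\<bar> \<le> 1")
    case True
    then show ?thesis
      using sign(1)[OF that True] \<tau> by (simp add: M that ut bd divide_right_mono)
  qed (simp add: mm_functional_infinite)
  have "AE x in lebesgue_on \<Omega>. v x = ?s x"
    if nz: "AE x in lebesgue_on \<Omega>. ?w x \<noteq> 0" and v: "is_arg_min ?M (\<lambda>v. v \<in> L2 \<Omega>) v" for v
  proof -
    have vL2: "v \<in> L2 \<Omega>" and le: "?M v \<le> ?M ?s"
      using v ut by (auto simp: is_arg_min_def not_less)
    \<comment> \<open>A minimizer has a finite value, because the value at \<open>?s\<close> is
      real.\<close>
    have vbd: "AE x in lebesgue_on \<Omega>. \<bar>v x\<bar> \<le> 1"
      using le M[OF ut bd, of "Suc n"] mm_functional_infinite[where v = v and z = "ut n"] by force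
    \<comment> \<open>The minus sign in \<open>M\<close> reverses the order. Together with the
      opposite bound from \<open>sign\<close> this gives equality, and \<open>nz\<close> then allows
      division by \<open>?w x\<close>.\<close>
    have "L2_inner \<Omega> ?s ?w \<le> L2_inner \<Omega> v ?w"
      using le \<tau> by (simp add: M vL2 vbd ut bd divide_le_cancel)
    then have "AE x in lebesgue_on \<Omega>. v x * ?w x = ?s x * ?w x"
      using sign[OF vL2 vbd] by simp
    with nz show ?thesis
      by eventually_elim simp
  qed
  moreover have "F B \<Omega> \<tau> ?s \<le> F B \<Omega> \<tau> (ut n)"
  proof -
    \<comment> \<open>The distance term is a nonnegative multiple of a real square here, and it
      vanishes for the competitor \<open>ut n\<close>, since the factor \<open>u x - v x\<close> in
      \<open>d\<close> is then 0.\<close>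
    have "F B \<Omega> \<tau> ?s \<le> ?M ?s"
      using \<tau> by (simp add: mm_functional_def ereal_le_add_self)
    also have "\<dots> \<le> ?M (ut n)"
      by (rule min[OF ut])
    also have "\<dots> = F B \<Omega> \<tau> (ut n)"
      by (simp add: mm_functional_def d_def)
    finally show ?thesis .
  qed
  ultimately show "is_arg_min ?M (\<lambda>v. v \<in> L2 \<Omega>) ?s
      \<and> ((AE x in lebesgue_on \<Omega>. ?w x \<noteq> 0) \<longrightarrow>
          (\<forall>v. is_arg_min ?M (\<lambda>v. v \<in> L2 \<Omega>) v \<longrightarrow> (AE x in lebesgue_on \<Omega>. v x = ?s x)))
      \<and> F B \<Omega> \<tau> ?s \<le> F B \<Omega> \<tau> (ut n)"
    using min ut by (auto simp: is_arg_min_def not_less)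
qed

end
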